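(* Let $\mathcal{L}$ be a quasi-definite linear functional with monic orthogonal polynomials $\{P_n\}_{n\ge0}$. Let $a_1,a_2\in\mathbb{R}$ and suppose the Geronimus transformations of $\mathcal{L}$ at $a_1$ and at $a_2$ are quasi-definite, with monic orthogonal polynomials $\mathcal{G}_n(x;a_1)$ and $\mathcal{G}_n(x;a_2)$ respectively. Let $(\beta_n)_{n\ge1}$ be complex numbers and let $\mathcal{G}_n^Q(x;a_1)=\mathcal{G}_n(x;a_1)+\beta_n\mathcal{G}_{n-1}(x;a_1)$, $n\ge1$, be the monic quasi-Geronimus polynomials of order one. Then there exist sequences of complex numbers $\{\gamma_n\}_{n\ge0}$ and $\{\eta_n\}_{n\ge0}$ such that, as an identity of rational functions in $x$, $$P_n(x)=\frac{1}{x-\gamma_n}\mathcal{G}_{n+1}^Q(x;a_1)+\frac{\eta_n}{x-\gamma_n}\mathcal{G}_n(x;a_2),\qquad n\ge0.$$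
   Context: A linear functional $\mathcal{L}$ on $\mathbb{C}[x]$ is quasi-definite if there is a (unique) sequence of monic polynomials $P_n$, $\deg P_n=n$, with $\mathcal{L}[P_nP_m]=0$ for $n\ne m$ and $\mathcal{L}[P_n^2]\neq0$; these are its monic orthogonal polynomials. The Geronimus transformation of $\mathcal{L}$ at $a\in\mathbb{R}$ with constant $M$ is $\mathcal{L}^G[p(x)]=\mathcal{L}\left[\frac{p(x)-p(a)}{x-a}\right]+Mp(a)$; each of the two transformations (at $a_1$ and $a_2$) has its own constant $M$. When $\mathcal{L}^G$ is quasi-definite, its monic orthogonal polynomials satisfy $\mathcal{G}_0=1$ and $\mathcal{G}_n(x;a)=P_n(x)+\chi_n(a)P_{n-1}(x)$ for $n\ge1$, where $\chi_n(a)=-\mathcal{L}^G[P_n]/\mathcal{L}^G[P_{n-1}]$ is well defined and nonzero. *)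

theory Defs
  imports "HOL-Computational_Algebra.Computational_Algebra"
begin

definition linear_functional :: "(complex poly \<Rightarrow> complex) \<Rightarrow> bool" where
  "linear_functional L \<longleftrightarrow> Vector_Spaces.linear smult (*) L"

definition monic_orthogonal :: "(complex poly \<Rightarrow> complex) \<Rightarrow> (nat \<Rightarrow> complex poly) \<Rightarrow> bool" where
  "monic_orthogonal L P \<longleftrightarrow>
     (\<forall>n. degree (P n) = n \<and> lead_coeff (P n) = 1) \<and>
     (\<forall>n m. n \<noteq> m \<longrightarrow> L (P n * P m) = 0) \<and>
     (\<forall>n. L ((P n)\<^sup>2) \<noteq> 0)"

definition quasi_definite :: "(complex poly \<Rightarrow> complex) \<Rightarrow> bool" where
  "quasi_definite L \<longleftrightarrow> (\<exists>P. monic_orthogonal L P)"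

(* The polynomial division is exact; see geronimus_division_exact. *)
definition geronimus ::
    "(complex poly \<Rightarrow> complex) \<Rightarrow> real \<Rightarrow> complex \<Rightarrow> complex poly \<Rightarrow> complex" where
  "geronimus L a M p =
     L ((p - [:poly p (of_real a):]) div [:- of_real a, 1:]) + M * poly p (of_real a)"

(* The order-one combination is defined for n >= 1 only. At index 0 it is set to G 0. *)
primrec quasi_geronimus ::
    "(nat \<Rightarrow> complex) \<Rightarrow> (nat \<Rightarrow> complex poly) \<Rightarrow> nat \<Rightarrow> complex poly" where
  "quasi_geronimus \<beta> G 0 = G 0"
| "quasi_geronimus \<beta> G (Suc n) = G (Suc n) + smult (\<beta> (Suc n)) (G n)"

lemma linear_functional_iff:
  "linear_functional L \<longleftrightarrow>
     (\<forall>p q. L (p + q) = L p + L q) \<and> (\<forall>c p. L (smult c p) = c * L p)"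
proof -
  have v: "vector_space (smult :: complex \<Rightarrow> complex poly \<Rightarrow> complex poly)"
    by unfold_locales (simp_all add: smult_add_right smult_add_left)
  have w: "vector_space ((*) :: complex \<Rightarrow> complex \<Rightarrow> complex)"
    by unfold_locales (simp_all add: algebra_simps)
  show ?thesis
    unfolding linear_functional_def Vector_Spaces.linear_iff using v w by auto
qed

lemma geronimus_division_exact:
  "[:- of_real a, 1:] * ((p - [:poly p (of_real a):]) div [:- of_real a, 1:])
     = p - [:poly p (of_real a :: complex):]"
proof -
  have "[:- of_real a, 1:] dvd p - [:poly p (of_real a :: complex):]"
    by (simp flip: poly_eq_0_iff_dvd)
  then show ?thesis by (rule dvd_mult_div_cancel)
qed

lemma monic_orthogonal_degree_less:
  assumes L: "linear_functional L" and P: "monic_orthogonal L P" and "degree q < n"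
  shows "L (P n * q) = 0"
  using assms(3)
proof (induction "degree q" arbitrary: q rule: less_induct)
  case less
  have add: "\<And>p r. L (p + r) = L p + L r" and sm: "\<And>c p. L (smult c p) = c * L p"
    using L by (auto simp: linear_functional_iff)
  have deg: "\<And>k. degree (P k) = k" and lc: "\<And>k. coeff (P k) k = 1"
    and orth: "\<And>k m. k \<noteq> m \<Longrightarrow> L (P k * P m) = 0"
    using P by (auto simp: monic_orthogonal_def) metis
  define d r where "d = degree q" and "r = q - smult (lead_coeff q) (P d)"
  have "q = smult (lead_coeff q) (P d) + r" by (simp add: r_def)
  then have "L (P n * q) = L (smult (lead_coeff q) (P n * P d) + P n * r)"
    by (metis distrib_left mult_smult_right)
  also have "\<dots> = L (P n * r)"
    using less.prems by (simp add: add sm orth d_def)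
  also have "\<dots> = 0"
  proof (cases "r = 0")
    case True
    then show ?thesis using sm[of 0 0] by simp
  next
    case False
    have "coeff r i = 0" if "i \<ge> d" for i
      using that deg[of d] lc[of d]
      by (cases "i = d") (auto simp: r_def d_def coeff_eq_0)
    then have "degree r < d"
      using False by (metis leading_coeff_0_iff not_le)
    then show ?thesis using less by (simp add: d_def)
  qed
  finally show ?case .
qed

lemma monic_orthogonal_unique:
  assumes L: "linear_functional L" and P: "monic_orthogonal L P" and Q: "monic_orthogonal L Q"
  shows "P = Q"
proof
  fix n
  have add: "\<And>p r. L (p + r) = L p + L r" and sm: "\<And>c p. L (smult c p) = c * L p"
    using L by (auto simp: linear_functional_iff)
  have deg: "\<And>k. degree (P k) = k" "\<And>k. degree (Q k) = k"
    and lc: "\<And>k. coeff (P k) k = 1" "\<And>k. coeff (Q k) k = 1"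
    and nz: "\<And>k. L (P k * P k) \<noteq> 0"
    using P Q by (auto simp: monic_orthogonal_def power2_eq_square) metis+
  show "P n = Q n"
  proof (rule ccontr)
    assume ne: "P n \<noteq> Q n"
    define D d where "D = P n - Q n" and "d = degree D"
    have D0: "D \<noteq> 0" using ne by (simp add: D_def)
    have "coeff D i = 0" if "i \<ge> n" for i
      using that deg[of n] lc[of n] by (cases "i = n") (auto simp: D_def coeff_eq_0)
    then have dn: "d < n"
      using D0 by (metis d_def leading_coeff_0_iff not_le)
    define r where "r = D - smult (lead_coeff D) (P d)"
    have "L (P n * P d) = 0" "L (Q n * P d) = 0"
      using monic_orthogonal_degree_less[OF L P] monic_orthogonal_degree_less[OF L Q] dn deg
      by auto
    moreover have "P n * P d = D * P d + Q n * P d" by (simp add: D_def algebra_simps)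
    ultimately have "L (D * P d) = 0" using add by simp
    moreover have "D * P d = smult (lead_coeff D) (P d * P d) + P d * r"
      by (simp add: r_def algebra_simps)
    moreover have "L (P d * r) = 0"
    proof (cases "r = 0")
      case True
      then show ?thesis using sm[of 0 0] by simp
    next
      case False
      have "coeff r i = 0" if "i \<ge> d" for i
        using that deg[of d] lc[of d]
        by (cases "i = d") (auto simp: r_def d_def coeff_eq_0)
      then have "degree r < d"
        using False by (metis leading_coeff_0_iff not_le)
      then show ?thesis using monic_orthogonal_degree_less[OF L P] by blast
    qed
    ultimately have "lead_coeff D * L (P d * P d) = 0" by (simp add: add sm)
    then show False using nz D0 by simp
  qed
qed

end

(* Since L^G[(x - a) p] = L[p], each Geronimus polynomial satisfies L[G_n q] = 0 for
   deg q <= n - 2, while L[G_n P_(n-1)] = L^G[G_n^2] is nonzero. Consider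
     D = (x - gamma) P_n - (G_(n+1)(x; a1) + beta_(n+1) G_n(x; a1)) - eta G_n(x; a2).
   Its terms of degree n + 1 cancel and L[D P_k] = 0 for k + 1 < n. Choosing eta makes
   L[D P_(n-1)] vanish, and then gamma removes the coefficient of x^n, which does not disturb
   the other conditions because L[P_n P_(n-1)] = 0. So D has degree below n and is
   orthogonal to P_0, ..., P_(n-1), which forces D = 0. *)
theory Submission
  imports Defs
begin

lemma linear_functional_add: "linear_functional L \<Longrightarrow> L (p + q) = L p + L q"
  and linear_functional_smult: "linear_functional L \<Longrightarrow> L (smult c p) = c * L p"
  by (simp_all add: linear_functional_iff)

lemma linear_functional_0: "linear_functional L \<Longrightarrow> L 0 = 0"
  using linear_functional_smult[of L 0 0] by simp

lemma linear_functional_diff: "linear_functional L \<Longrightarrow> L (p - q) = L p - L q"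
  using linear_functional_add[of L "p - q" q] by simp

lemma monic_orthogonal_degree: "monic_orthogonal L P \<Longrightarrow> degree (P n) = n"
  and monic_orthogonal_square_nonzero: "monic_orthogonal L P \<Longrightarrow> L ((P n)\<^sup>2) \<noteq> 0"
  by (auto simp: monic_orthogonal_def)

lemma monic_orthogonal_coeff: "monic_orthogonal L P \<Longrightarrow> coeff (P n) n = 1"
  by (metis monic_orthogonal_def)

text \<open>Subtracting \<open>coeff q n\<close> times \<open>P n\<close> from \<open>q\<close>
  leaves a remainder of degree below \<open>n\<close>, which pairs to zero with
  \<open>P n\<close>.\<close>

lemma monic_orthogonal_degree_le:
  assumes L: "linear_functional L" and P: "monic_orthogonal L P" and q: "degree q \<le> n"
  shows "L (P n * q) = coeff q n * L ((P n)\<^sup>2)"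
proof -
  define r where "r = q - smult (coeff q n) (P n)"
  have "coeff r i = 0" if "i \<ge> n" for i
    using that q monic_orthogonal_degree[OF P, of n] monic_orthogonal_coeff[OF P, of n]
    by (cases "i = n") (auto simp: r_def coeff_eq_0)
  then have "r = 0 \<or> degree r < n"
    by (metis leading_coeff_0_iff not_le)
  then have "L (P n * r) = 0"
    using monic_orthogonal_degree_less[OF L P] linear_functional_0[OF L] by auto
  moreover have "P n * q = smult (coeff q n) ((P n)\<^sup>2) + P n * r"
    by (simp add: r_def algebra_simps power2_eq_square)
  ultimately show ?thesis
    by (simp add: linear_functional_add[OF L] linear_functional_smult[OF L])
qed

text \<open>A nonzero \<open>D\<close> would have some degree d < n, and its pairing with
  \<open>P d\<close> would be the leading coefficient of \<open>D\<close> times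
  \<open>L ((P d)\<^sup>2)\<close>, hence nonzero.\<close>

lemma monic_orthogonal_nondegenerate:
  assumes L: "linear_functional L" and P: "monic_orthogonal L P"
    and coeff: "\<And>i. i \<ge> n \<Longrightarrow> coeff D i = 0"
    and orth: "\<And>k. k < n \<Longrightarrow> L (D * P k) = 0"
  shows "D = 0"
proof (rule ccontr)
  assume "D \<noteq> 0"
  then have "lead_coeff D \<noteq> 0" by simp
  then have "degree D < n" using coeff not_le by blast
  then have "L (P (degree D) * D) = 0" using orth by (simp add: mult.commute)
  then show False
    using monic_orthogonal_degree_le[OF L P order_refl] \<open>lead_coeff D \<noteq> 0\<close>
      monic_orthogonal_square_nonzero[OF P] by simp
qed

text \<open>Evaluation at a point and division by a fixed polynomial over a field are both linear in
  the dividend.\<close>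

lemma linear_functional_geronimus:
  assumes "linear_functional L"
  shows "linear_functional (geronimus L a M)"
proof -
  let ?x = "complex_of_real a"
  have "p + q - [:poly (p + q) ?x:] = (p - [:poly p ?x:]) + (q - [:poly q ?x:])" for p q
    by simp
  then have "geronimus L a M (p + q) = geronimus L a M p + geronimus L a M q" for p q
    unfolding geronimus_def
    by (simp only: poly_div_add_left linear_functional_add[OF assms] poly_add)
       (simp only: distrib_left ac_simps)
  moreover have "smult c p - [:poly (smult c p) ?x:] = smult c (p - [:poly p ?x:])" for c p
    by (simp add: smult_diff_right)
  then have "geronimus L a M (smult c p) = c * geronimus L a M p" for c p
    unfolding geronimus_def
    by (simp only: div_smult_left linear_functional_smult[OF assms] poly_smult)
       (simp only: distrib_left ac_simps)
  ultimately show ?thesis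
    by (simp add: linear_functional_iff)
qed

text \<open>The product vanishes at \<open>a\<close>, so the subtracted constant and the mass term
  both drop out and the division cancels the factor. This is the bridge between the two functionals,
  whatever \<open>M\<close> is.\<close>

lemma geronimus_linear_factor: "geronimus L a M ([:- of_real a, 1:] * p) = L p"
proof -
  have "poly ([:- of_real a, 1:] * p) (of_real a) = 0" by simp
  then show ?thesis
    unfolding geronimus_def
    by (metis add.right_neutral diff_zero mult_zero_right nonzero_mult_div_cancel_left pCons_0_0
        pCons_eq_0_iff zero_neq_one)
qed

text \<open>Passing from \<open>L\<close> to its transform multiplies \<open>q\<close> by x - a;
  this costs one degree, whence the bound on \<open>degree q + 1\<close>.\<close>

lemma geronimus_orthogonal_degree_less:
  assumes L: "linear_functional L" and G: "monic_orthogonal (geronimus L a M) G"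
    and "degree q + 1 < n"
  shows "L (G n * q) = 0"
proof -
  have "degree ([:- complex_of_real a, 1:] * q) < n"
    using degree_mult_le[of "[:- complex_of_real a, 1:]" q] assms(3) by simp
  then have "geronimus L a M (G n * ([:- of_real a, 1:] * q)) = 0"
    by (rule monic_orthogonal_degree_less[OF linear_functional_geronimus[OF L] G])
  then show ?thesis
    using geronimus_linear_factor[of L a M "G n * q"] by (simp only: mult.left_commute)
qed

text \<open>The factor x - a turns \<open>P k\<close> into a monic polynomial of degree
  \<open>Suc k\<close>, so the pairing is the transform's value at the square of
  \<open>G (Suc k)\<close>.\<close>

lemma geronimus_orthogonal_predecessor:
  assumes L: "linear_functional L" and P: "monic_orthogonal L P"
    and G: "monic_orthogonal (geronimus L a M) G"
  shows "L (G (Suc k) * P k) \<noteq> 0"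
proof -
  let ?q = "[:- complex_of_real a, 1:] * P k"
  have "degree ?q \<le> Suc k"
    using degree_mult_le[of "[:- complex_of_real a, 1:]" "P k"]
    by (simp add: monic_orthogonal_degree[OF P])
  moreover have "coeff ?q (Suc k) = 1"
    using monic_orthogonal_coeff[OF P, of k] monic_orthogonal_degree[OF P, of k]
    by (simp add: coeff_eq_0)
  ultimately have "geronimus L a M (G (Suc k) * ?q) \<noteq> 0"
    using monic_orthogonal_degree_le[OF linear_functional_geronimus[OF L] G]
      monic_orthogonal_square_nonzero[OF G] by simp
  then show ?thesis
    using geronimus_linear_factor[of L a M "G (Suc k) * P k"]
    by (simp only: mult.left_commute not_False_eq_True)
qed

text \<open>This is the target identity with denominators cleared, for one \<open>n\<close>. Only
  successor indices of \<open>quasi_geronimus\<close> occur, so its value at 0 never enters.\<close>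

lemma quasi_geronimus_recovery:
  assumes L: "linear_functional L" and P: "monic_orthogonal L P"
    and G1: "monic_orthogonal (geronimus L a1 M1) G1"
    and G2: "monic_orthogonal (geronimus L a2 M2) G2"
  shows "\<exists>\<gamma> \<eta>. [:- \<gamma>, 1:] * P n = quasi_geronimus \<beta> G1 (Suc n) + smult \<eta> (G2 n)"
proof -
  define Q where "Q = quasi_geronimus \<beta> G1 (Suc n)"
  note lin = linear_functional_add[OF L] linear_functional_smult[OF L] linear_functional_diff[OF L]
  note deg = monic_orthogonal_degree[OF P] monic_orthogonal_degree[OF G1] monic_orthogonal_degree[OF G2]
  (* For n = 0 the value of eta is immaterial: gamma absorbs it. *)
  define \<eta> where "\<eta> = L (([:0, 1:] * P n - Q) * P (n - 1)) / L (G2 n * P (n - 1))"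
  define R where "R = [:0, 1:] * P n - Q - smult \<eta> (G2 n)"
  \<comment> \<open>Since \<open>P n\<close> is monic, subtracting this multiple of it clears the
    coefficient of x^n. It is fixed after \<open>\<eta>\<close>, on which \<open>R\<close>
    depends.\<close>
  define \<gamma> where "\<gamma> = coeff R n"
  define D where "D = R - smult \<gamma> (P n)"
  have "D = 0"
  proof (rule monic_orthogonal_nondegenerate[OF L P])
    fix i assume "n \<le> i"
    then consider "i = n" | "i = Suc n" | "i > Suc n" by linarith
    then show "coeff D i = 0"
    proof cases
      case 1
      then show ?thesis by (simp add: D_def \<gamma>_def monic_orthogonal_coeff[OF P])
    next
      case 2
      then show ?thesis
        \<comment> \<open>The leading terms of x \<open>P n\<close> and \<open>Q\<close> are both
          x^(n+1) and cancel.\<close>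
        using monic_orthogonal_coeff[OF P, of n] monic_orthogonal_coeff[OF G1, of "Suc n"]
        by (simp add: D_def R_def Q_def coeff_eq_0 deg)
    next
      case 3
      then show ?thesis
        by (cases i) (simp_all add: D_def R_def Q_def coeff_eq_0 deg)
    qed
  next
    fix k assume k: "k < n"
    have "L (P n * P k) = 0"
      using monic_orthogonal_degree_less[OF L P] k deg by simp
    then have DR: "L (D * P k) = L (R * P k)"
      by (simp add: D_def left_diff_distrib lin)
    show "L (D * P k) = 0"
    proof (cases "Suc k = n")
      case True
      \<comment> \<open>This is the one condition that \<open>\<eta>\<close> was chosen to meet; the
        denominator in its definition is nonzero here.\<close>
      then have "L (G2 n * P k) \<noteq> 0"
        using geronimus_orthogonal_predecessor[OF L P G2] by blast
      moreover have "k = n - 1" using True by simp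
      moreover have "R * P k = ([:0, 1:] * P n - Q) * P k - smult \<eta> (G2 n * P k)"
        by (simp add: R_def left_diff_distrib)
      ultimately show ?thesis
        unfolding DR by (simp add: lin \<eta>_def del: mult_pCons_left)
    next
      case False
      \<comment> \<open>Now k + 1 < n. Moving the factor x from \<open>P n\<close> to
        \<open>P k\<close> still leaves degree below \<open>n\<close>, and the same inequality
        absorbs the degree lost for \<open>G1\<close> and \<open>G2\<close>.\<close>
      have "degree ([:0, 1:] * P k) < n"
        using degree_mult_le[of "[:0, 1:]" "P k"] k False by (simp add: deg)
      then have "L (P n * ([:0, 1:] * P k)) = 0"
        by (rule monic_orthogonal_degree_less[OF L P])
      moreover have "L (G1 (Suc n) * P k) = 0" "L (G1 n * P k) = 0" "L (G2 n * P k) = 0"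
        using k False deg
        by (auto intro!: geronimus_orthogonal_degree_less[OF L G1]
            geronimus_orthogonal_degree_less[OF L G2])
      moreover have "R * P k = P n * ([:0, 1:] * P k) - G1 (Suc n) * P k
          - smult (\<beta> (Suc n)) (G1 n * P k) - smult \<eta> (G2 n * P k)"
        by (simp add: R_def Q_def algebra_simps)
      ultimately show ?thesis
        unfolding DR by (simp add: lin del: mult_pCons_left mult_pCons_right)
    qed
  qed
  then have "[:- \<gamma>, 1:] * P n = Q + smult \<eta> (G2 n)"
    by (simp add: D_def R_def algebra_simps)
  then show ?thesis unfolding Q_def by blast
qed

theorem theorem3p2:
  fixes L :: "complex poly \<Rightarrow> complex"
    and P G1 G2 :: "nat \<Rightarrow> complex poly"
    and a1 a2 :: real
    and M1 M2 :: complex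
    and \<beta> :: "nat \<Rightarrow> complex"
  assumes "linear_functional L"
    and "quasi_definite L"
    and "monic_orthogonal L P"
    and "quasi_definite (geronimus L a1 M1)"
    and "monic_orthogonal (geronimus L a1 M1) G1"
    and "quasi_definite (geronimus L a2 M2)"
    and "monic_orthogonal (geronimus L a2 M2) G2"
  shows "\<exists>\<gamma> \<eta> :: nat \<Rightarrow> complex. \<forall>n.
           to_fract (P n) =
             1 / to_fract [:- \<gamma> n, 1:] * to_fract (quasi_geronimus \<beta> G1 (n + 1)) +
             to_fract [:\<eta> n:] / to_fract [:- \<gamma> n, 1:] * to_fract (G2 n)"
proof -
  obtain \<gamma> \<eta> where eq: "\<And>n. [:- \<gamma> n, 1:] * P n = quasi_geronimus \<beta> G1 (Suc n) + smult (\<eta> n) (G2 n)"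
  proof -
    have "\<forall>n. \<exists>\<gamma> \<eta>. [:- \<gamma>, 1:] * P n = quasi_geronimus \<beta> G1 (Suc n) + smult \<eta> (G2 n)"
      using quasi_geronimus_recovery[OF assms(1,3,5,7)] by blast
    then show ?thesis
      using that unfolding choice_iff by blast
  qed
  have "to_fract (P n) =
      1 / to_fract [:- \<gamma> n, 1:] * to_fract (quasi_geronimus \<beta> G1 (n + 1)) +
      to_fract [:\<eta> n:] / to_fract [:- \<gamma> n, 1:] * to_fract (G2 n)" for n
  proof -
    have "to_fract [:- \<gamma> n, 1:] * to_fract (P n) =
        to_fract (quasi_geronimus \<beta> G1 (n + 1)) + to_fract [:\<eta> n:] * to_fract (G2 n)"
      using arg_cong[OF eq[of n], of to_fract] by (simp flip: to_fract_mult to_fract_add)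
    \<comment> \<open>In the fraction field one may divide by x - \<gamma>, a nonzero polynomial,
      although it has a root.\<close>
    moreover have "to_fract [:- \<gamma> n, 1:] \<noteq> 0"
      by simp
    ultimately show ?thesis
      by (simp add: field_simps del: quasi_geronimus.simps)
  qed
  then show ?thesis by blast
qed

end
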